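(* Let $m,n\in\mathbb{N}$, let $x\in C^{n+1}\left(\prod_{i=1}^m[a_i,b_i],\mathbb{R}\right)$, and let $\alpha_k:[a_k,b_k]\to(0,1)$ for $k\in\{1,\ldots,m\}$. Then, for all $k\in\{1,\ldots,m\}$, all $N\in\mathbb{N}$ with $N\geq n$, and all $\overline t=(t_1,\ldots,t_m)\in\prod_{i=1}^m[a_i,b_i]$ with $t_k>a_k$, writing $\alpha=\alpha_k(t_k)$, $$ {}^{C}_{a_k}\mathbb{D}_{t_k}^{\alpha_k(t_k)} x(\overline t)=\sum_{p=1}^{n}A_p\,(t_k-a_k)^{p-\alpha}\,\frac{\partial^p x}{\partial t_k^p}[t_k]_k+\sum_{p=n}^N B_p\,(t_k-a_k)^{n-p-\alpha}\,V_p(\overline t)+E(\overline t), $$ where the approximation error $E(\overline t)$ is bounded by $$ E(\overline t)\leq L_{n+1}(\overline t)\,\frac{\exp\left((n-\alpha)^2+n-\alpha\right)}{\Gamma(n+1-\alpha)\,N^{n-\alpha}\,(n-\alpha)}\,(t_k-a_k)^{n+1-\alpha}. $$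
   Context: $\Gamma$ is the Gamma function. For $\overline t=(t_1,\ldots,t_m)$ and $\tau\in[a_k,b_k]$, put $[\tau]_k=(t_1,\ldots,t_{k-1},\tau,t_{k+1},\ldots,t_m)\in\mathbb{R}^m$ (so $[t_k]_k=\overline t$); $\frac{\partial^p x}{\partial t_k^p}[\tau]_k$ is the $p$-th partial derivative of $x$ in the $k$-th variable evaluated at $[\tau]_k$. The type III partial left Caputo derivative of order $\alpha_k(t_k)$ is $$ {}^{C}_{a_k}\mathbb{D}_{t_k}^{\alpha_k(t_k)} x(\overline t)=\frac{1}{\Gamma(1-\alpha_k(t_k))}\int_{a_k}^{t_k}(t_k-\tau)^{-\alpha_k(t_k)}\frac{\partial x}{\partial t_k}[\tau]_k\,d\tau . $$ For fixed $n,N,k,\overline t$ and with $\alpha=\alpha_k(t_k)$, define $$ A_p=\frac{1}{\Gamma(p+1-\alpha)}\left[1+\sum_{l=n-p+1}^N\frac{\Gamma(\alpha-n+l)}{\Gamma(\alpha-p)\,(l-n+p)!}\right]\ (1\le p\le n),\qquad B_p=\frac{\Gamma(\alpha-n+p)}{\Gamma(1-\alpha)\Gamma(\alpha)\,(p-n)!}\ (p\ge n), $$ $$ V_p(\overline t)=\int_{a_k}^{t_k}(\tau-a_k)^{p-n}\frac{\partial x}{\partial t_k}[\tau]_k\,d\tau\ (p\ge n),\qquad L_p(\overline t)=\max_{\tau\in[a_k,t_k]}\left|\frac{\partial^p x}{\partial t_k^p}[\tau]_k\right|, $$ with the convention $(\tau-a_k)^0=1$. *)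

theory Defs
  imports "HOL-Analysis.Analysis"
begin

definition replace_coord :: "real ^ 'm \<Rightarrow> 'm \<Rightarrow> real \<Rightarrow> real ^ 'm" where
  "replace_coord t k \<tau> = (\<chi> i. if i = k then \<tau> else t $ i)"

text \<open>Derivatives are taken relative to the box \<open>cbox a b\<close>: at the faces
  \<open>t $ k = a $ k\<close> and \<open>t $ k = b $ k\<close> they are one-sided.\<close>

definition has_partial_on_box :: "real ^ 'm \<Rightarrow> real ^ 'm \<Rightarrow> 'm \<Rightarrow> (real ^ 'm \<Rightarrow> real) \<Rightarrow> bool" where
  "has_partial_on_box a b k x \<longleftrightarrow>
     (\<forall>t \<in> cbox a b. (\<lambda>\<tau>. x (replace_coord t k \<tau>)) differentiable (at (t $ k) within {a $ k..b $ k}))"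

definition partial :: "real ^ 'm \<Rightarrow> real ^ 'm \<Rightarrow> 'm \<Rightarrow> (real ^ 'm \<Rightarrow> real) \<Rightarrow> real ^ 'm \<Rightarrow> real" where
  "partial a b k x t =
     vector_derivative (\<lambda>\<tau>. x (replace_coord t k \<tau>)) (at (t $ k) within {a $ k..b $ k})"

definition partial_pow ::
  "real ^ 'm \<Rightarrow> real ^ 'm \<Rightarrow> 'm \<Rightarrow> nat \<Rightarrow> (real ^ 'm \<Rightarrow> real) \<Rightarrow> real ^ 'm \<Rightarrow> real" where
  "partial_pow a b k p x = (partial a b k ^^ p) x"

text \<open>All (mixed) partial derivatives of order at most \<open>r\<close> exist and are continuous on the
  closed box. If \<open>a $ i = b $ i\<close> for some \<open>i\<close>, the partial derivative in direction \<open>i\<close> is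
  an unspecified constant, so that such a direction imposes no condition.\<close>

primrec C_on_box :: "nat \<Rightarrow> real ^ 'm \<Rightarrow> real ^ 'm \<Rightarrow> (real ^ 'm \<Rightarrow> real) \<Rightarrow> bool" where
  "C_on_box 0 a b x \<longleftrightarrow> continuous_on (cbox a b) x"
| "C_on_box (Suc r) a b x \<longleftrightarrow> continuous_on (cbox a b) x \<and>
     (\<forall>i. has_partial_on_box a b i x \<and> C_on_box r a b (partial a b i x))"

definition caputo3 ::
  "real ^ 'm \<Rightarrow> real ^ 'm \<Rightarrow> 'm \<Rightarrow> (real \<Rightarrow> real) \<Rightarrow> (real ^ 'm \<Rightarrow> real) \<Rightarrow> real ^ 'm \<Rightarrow> real" where
  "caputo3 a b k \<alpha> x t =
     1 / Gamma (1 - \<alpha> (t $ k)) *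
     integral {a $ k..t $ k}
       (\<lambda>\<tau>. (t $ k - \<tau>) powr (- \<alpha> (t $ k)) * partial a b k x (replace_coord t k \<tau>))"

text \<open>The order \<open>\<alpha>\<close> is a number from here on. Subtractions of natural numbers do not truncate in
  the ranges that matter: \<open>p \<le> n\<close> and \<open>l \<ge> n - p\<close> in \<open>coeff_A\<close>, and \<open>n \<le> p\<close> in \<open>coeff_B\<close> and
  \<open>V_int\<close>.\<close>

definition coeff_A :: "nat \<Rightarrow> nat \<Rightarrow> real \<Rightarrow> nat \<Rightarrow> real" where
  "coeff_A n N \<alpha> p =
     1 / Gamma (real p + 1 - \<alpha>) *
     (1 + (\<Sum>l = n - p + 1..N. Gamma (\<alpha> - real n + real l) / (Gamma (\<alpha> - real p) * fact (l + p - n))))"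

definition coeff_B :: "nat \<Rightarrow> real \<Rightarrow> nat \<Rightarrow> real" where
  "coeff_B n \<alpha> p = Gamma (\<alpha> - real n + real p) / (Gamma (1 - \<alpha>) * Gamma \<alpha> * fact (p - n))"

definition V_int ::
  "real ^ 'm \<Rightarrow> real ^ 'm \<Rightarrow> 'm \<Rightarrow> (real ^ 'm \<Rightarrow> real) \<Rightarrow> nat \<Rightarrow> nat \<Rightarrow> real ^ 'm \<Rightarrow> real" where
  "V_int a b k x n p t =
     integral {a $ k..t $ k} (\<lambda>\<tau>. (\<tau> - a $ k) ^ (p - n) * partial a b k x (replace_coord t k \<tau>))"

definition L_max ::
  "real ^ 'm \<Rightarrow> real ^ 'm \<Rightarrow> 'm \<Rightarrow> (real ^ 'm \<Rightarrow> real) \<Rightarrow> nat \<Rightarrow> real ^ 'm \<Rightarrow> real" where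
  "L_max a b k x p t =
     (GREATEST y. y \<in> (\<lambda>\<tau>. \<bar>partial_pow a b k p x (replace_coord t k \<tau>)\<bar>) ` {a $ k..t $ k})"

end

theory Submission
  imports Defs
begin

text \<open>
  Put \<open>h = t\<^sub>k - a\<^sub>k\<close>, \<open>u = (\<tau> - a\<^sub>k) / h\<close> and let \<open>K\<^sub>p(\<tau>)\<close> be the remainder left when the
  fractional kernel \<open>(t\<^sub>k - \<tau>) powr (p - \<alpha>) / \<Gamma>(p + 1 - \<alpha>)\<close> is replaced by its binomial expansion
  in powers of \<open>u\<close> up to degree \<open>N - n + p\<close>. With these degrees, differentiation takes the
  truncation for \<open>p + 1\<close> to minus the one for \<open>p\<close>, so \<open>K\<^bsub>p+1\<^esub>' = - K\<^sub>p\<close>; moreover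
  \<open>K\<^sub>p(a\<^sub>k) = 0\<close>, and \<open>K\<^sub>p(t\<^sub>k) = - A\<^sub>p h powr (p - \<alpha>)\<close> for \<open>p \<ge> 1\<close>.

  The polynomial removed from the Caputo kernel to form \<open>K\<^sub>0\<close> integrates to the sum over
  \<open>B\<^sub>p V\<^sub>p\<close>. In what is left, the integral of \<open>K\<^sub>0 \<partial>x/\<partial>t\<^sub>k\<close>, integrating by parts \<open>n\<close> times
  produces exactly the boundary terms with \<open>A\<^sub>1, \<dots>, A\<^sub>n\<close> and leaves the error
  \<open>E = \<integral> K\<^sub>n \<partial>\<^bsup>n+1\<^esup>x/\<partial>t\<^sub>k\<^bsup>n+1\<^esup>\<close> (\<open>integral_fractional_kernel\<close>).

  For the bound, the expansion of \<open>(1 - u) powr (- \<alpha>)\<close> has nonnegative coefficients, so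
  \<open>K\<^sub>0 \<ge> 0\<close> to the left of \<open>t\<^sub>k\<close>. As \<open>K\<^bsub>p+1\<^esub>' = - K\<^sub>p\<close> and all \<open>K\<^sub>p\<close> vanish at \<open>a\<^sub>k\<close>, by
  induction \<open>(-1)\<^sup>p K\<^sub>p\<close> is nonnegative and, for \<open>p \<ge> 1\<close>, nondecreasing; hence \<open>\<bar>K\<^sub>n\<bar>\<close> is largest at \<open>t\<^sub>k\<close>. There the
  alternating sum of binomial coefficients collapses to a single one,
  \<open>\<bar>K\<^sub>n(t\<^sub>k)\<bar> = h powr (n - \<alpha>) / \<Gamma>(n + 1 - \<alpha>) * \<Prod>\<^bsub>j=1..N\<^esub> \<bar>1 - (n - \<alpha>) / j\<bar>\<close>, and the product is
  estimated factor by factor (\<open>abs_gbinomial_bound\<close>).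
\<close>

section \<open>Remainders of the binomial series\<close>

definition binomial_remainder :: "real \<Rightarrow> nat \<Rightarrow> real \<Rightarrow> real" where
  "binomial_remainder \<mu> m u = (1 - u) powr \<mu> - (\<Sum>j\<le>m. (-1) ^ j * (\<mu> gchoose j) * u ^ j)"

lemma binomial_remainder_0 [simp]: "binomial_remainder \<mu> m 0 = 0"
proof -
  have "(\<Sum>j\<le>m. (-1) ^ j * (\<mu> gchoose j) * (0::real) ^ j) = (\<Sum>j\<le>m. if j = 0 then 1 else 0)"
    by (intro sum.cong) auto
  then show ?thesis
    by (simp add: binomial_remainder_def)
qed

lemma binomial_remainder_1: "binomial_remainder \<mu> m 1 = - ((-1) ^ m * (\<mu> - 1 gchoose m))"
  using gbinomial_sum_lower_neg[of \<mu> m]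
  by (simp add: binomial_remainder_def mult.commute)

lemma continuous_on_binomial_remainder:
  assumes "\<mu> > 0"
  shows "continuous_on {0..1} (binomial_remainder \<mu> m)"
  unfolding binomial_remainder_def
  using assms by (intro continuous_intros continuous_on_powr') auto

text \<open>Termwise differentiation, by the absorption identity for binomial coefficients.\<close>

lemma has_real_derivative_binomial_remainder:
  assumes "u < 1"
  shows "(binomial_remainder \<mu> (Suc m) has_real_derivative
           - \<mu> * binomial_remainder (\<mu> - 1) m u) (at u)"
proof -
  have "((\<lambda>u. \<Sum>j\<le>Suc m. (-1) ^ j * (\<mu> gchoose j) * u ^ j) has_real_derivative
      (\<Sum>j\<le>Suc m. (-1) ^ j * (\<mu> gchoose j) * (real j * u ^ (j - 1)))) (at u)"
    by (intro DERIV_sum DERIV_cmult) (auto intro!: derivative_eq_intros)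
  also have "(\<Sum>j\<le>Suc m. (-1) ^ j * (\<mu> gchoose j) * (real j * u ^ (j - 1))) =
      (\<Sum>j\<le>m. - ((-1) ^ j * (real (Suc j) * (\<mu> gchoose Suc j)) * u ^ j))"
    by (subst sum.atMost_Suc_shift) (simp add: mult_ac)
  also have "\<dots> = - \<mu> * (\<Sum>j\<le>m. (-1) ^ j * (\<mu> - 1 gchoose j) * u ^ j)"
    unfolding gbinomial_absorption by (simp add: sum_negf sum_distrib_left mult_ac)
  finally have poly: "((\<lambda>u. \<Sum>j\<le>Suc m. (-1) ^ j * (\<mu> gchoose j) * u ^ j) has_real_derivative
      - \<mu> * (\<Sum>j\<le>m. (-1) ^ j * (\<mu> - 1 gchoose j) * u ^ j)) (at u)" .
  have "((\<lambda>u. (1 - u) powr \<mu>) has_real_derivative - \<mu> * (1 - u) powr (\<mu> - 1)) (at u)"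
    using assms by (auto intro!: derivative_eq_intros)
  from DERIV_diff[OF this poly] show ?thesis
    unfolding binomial_remainder_def by (simp add: algebra_simps)
qed

lemma alternating_gbinomial_pochhammer:
  "(-1) ^ j * (\<mu> gchoose j) = pochhammer (- \<mu>) j / (fact j :: real)"
  by (simp add: gbinomial_pochhammer flip: power_mult_distrib)

text \<open>For a negative exponent all terms of the series are nonnegative, so a partial sum stays
  below the limit.\<close>

lemma binomial_remainder_negative_exponent_nonneg:
  assumes "\<alpha> > 0" "0 \<le> u" "u < 1"
  shows "binomial_remainder (- \<alpha>) m u \<ge> 0"
proof -
  have sums: "(\<lambda>j. (-1) ^ j * (- \<alpha> gchoose j) * u ^ j) sums (1 - u) powr (- \<alpha>)"
    using gen_binomial_real[of "- u" "- \<alpha>"] assms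
    by (simp add: power_minus[of u] mult_ac)
  have "(\<Sum>j<Suc m. (-1) ^ j * (- \<alpha> gchoose j) * u ^ j) \<le>
      (\<Sum>j. (-1) ^ j * (- \<alpha> gchoose j) * u ^ j)"
    using assms
    by (intro sum_le_suminf sums_summable[OF sums])
       (auto simp: alternating_gbinomial_pochhammer intro!: mult_nonneg_nonneg
          divide_nonneg_pos less_imp_le[OF pochhammer_pos])
  then show ?thesis
    using sums_unique[OF sums] by (simp add: binomial_remainder_def lessThan_Suc_atMost)
qed

text \<open>Each step up in the exponent integrates the previous remainder from \<open>0\<close> and flips its sign;
  so signed remainders are nonnegative, and nonnegativity of one gives monotonicity of the next.\<close>

lemma binomial_remainder_mono:
  assumes "\<mu> > 0"
    and nonneg: "\<And>u. 0 \<le> u \<Longrightarrow> u < 1 \<Longrightarrow> (-1) ^ p * binomial_remainder (\<mu> - 1) m u \<ge> 0"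
    and "0 \<le> u" "u \<le> v" "v \<le> 1"
  shows "(-1) ^ Suc p * binomial_remainder \<mu> (Suc m) u
    \<le> (-1) ^ Suc p * binomial_remainder \<mu> (Suc m) v"
proof (rule DERIV_nonneg_imp_increasing_open[where
      f = "\<lambda>u. (-1) ^ Suc p * binomial_remainder \<mu> (Suc m) u"])
  show "continuous_on {u..v} (\<lambda>u. (-1) ^ Suc p * binomial_remainder \<mu> (Suc m) u)"
    using assms
    by (intro continuous_intros continuous_on_subset[OF continuous_on_binomial_remainder]) auto
next
  fix w assume w: "u < w" "w < v"
  have "((\<lambda>u. (-1) ^ Suc p * binomial_remainder \<mu> (Suc m) u) has_real_derivative
      (-1) ^ Suc p * (- \<mu> * binomial_remainder (\<mu> - 1) m w)) (at w)"
    using w assms by (intro DERIV_cmult has_real_derivative_binomial_remainder) auto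
  moreover have "(-1) ^ Suc p * (- \<mu> * binomial_remainder (\<mu> - 1) m w) \<ge> 0"
    using mult_nonneg_nonneg[OF less_imp_le[OF \<open>\<mu> > 0\<close>] nonneg[of w]] w assms
    by (simp add: mult_ac)
  ultimately show "\<exists>y. ((\<lambda>u. (-1) ^ Suc p * binomial_remainder \<mu> (Suc m) u)
      has_real_derivative y) (at w) \<and> 0 \<le> y"
    by blast
qed (use assms in auto)

lemma binomial_remainder_sign:
  assumes "0 < \<alpha>" "\<alpha> < 1" "0 \<le> u" "u < 1"
  shows "(-1) ^ p * binomial_remainder (real p - \<alpha>) (m + p) u \<ge> 0"
  using assms(3,4)
proof (induction p arbitrary: u)
  case 0
  then show ?case
    using binomial_remainder_negative_exponent_nonneg[of \<alpha> u m] assms by simp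
next
  case (Suc p)
  show ?case
    using binomial_remainder_mono[of "real (Suc p) - \<alpha>" p "m + p" 0 u] Suc assms by simp
qed

lemma abs_binomial_remainder_le:
  assumes "0 < \<alpha>" "\<alpha> < 1" "0 \<le> u" "u \<le> 1"
  shows "\<bar>binomial_remainder (real (Suc p) - \<alpha>) (m + Suc p) u\<bar>
    \<le> \<bar>real (Suc p) - \<alpha> - 1 gchoose (m + Suc p)\<bar>"
proof -
  let ?R = "\<lambda>u. (-1) ^ Suc p * binomial_remainder (real (Suc p) - \<alpha>) (Suc (m + p)) u"
  have mono: "?R v \<le> ?R w" if "0 \<le> v" "v \<le> w" "w \<le> 1" for v w
    using that assms binomial_remainder_sign[of \<alpha> _ p m]
    by (intro binomial_remainder_mono) (auto simp: algebra_simps)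
  have "0 \<le> ?R u" "?R u \<le> ?R 1"
    using mono[of 0 u] mono[of u 1] assms by auto
  then have "\<bar>?R u\<bar> \<le> \<bar>?R 1\<bar>"
    by linarith
  then show ?thesis
    by (simp add: abs_mult power_abs binomial_remainder_1)
qed

section \<open>Decay of binomial coefficients\<close>

text \<open>For \<open>y \<ge> 1\<close> the inequality is \<open>y - 1 \<le> exp (y - 2)\<close> combined with \<open>(y - 2)\<^sup>2 \<ge> 0\<close>. The factor
  \<open>1/2\<close> of \<open>y\<^sup>2\<close> matters: it compensates for \<open>\<Sum> 1/j\<^sup>2 \<le> 2\<close> below.\<close>

lemma abs_one_minus_le_exp: "\<bar>1 - y\<bar> \<le> exp (y\<^sup>2 / 2 - y)" for y :: real
proof (cases "y \<le> 1")
  case True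
  have "1 - y \<le> exp (- y)"
    using exp_ge_add_one_self[of "- y"] by simp
  also have "\<dots> \<le> exp (y\<^sup>2 / 2 - y)"
    by simp
  finally show ?thesis
    using True by simp
next
  case False
  have "y - 1 \<le> exp (y - 2)"
    using exp_ge_add_one_self[of "y - 2"] by simp
  also have "y - 2 \<le> y\<^sup>2 / 2 - y"
    using zero_le_power2[of "y - 2"] by (simp add: power2_eq_square algebra_simps)
  finally show ?thesis
    using False by simp
qed

lemma sum_inverse_squares_le_2: "(\<Sum>j=1..m. 1 / (real j)\<^sup>2) \<le> 2"
proof -
  have "(\<Sum>j=1..Suc m. 1 / (real j)\<^sup>2) \<le> 2 - 1 / real (Suc m)" for m
  proof (induction m)
    case (Suc m)
    have "1 / (real (Suc (Suc m)))\<^sup>2 \<le> 1 / real (Suc m) - 1 / real (Suc (Suc m))"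
    proof -
      have "1 / (real (Suc (Suc m)))\<^sup>2 \<le> 1 / (real (Suc m) * real (Suc (Suc m)))"
        by (intro divide_left_mono) (auto simp: power2_eq_square)
      also have "\<dots> = 1 / real (Suc m) - 1 / real (Suc (Suc m))"
        by (simp add: field_simps)
      finally show ?thesis .
    qed
    with Suc show ?case by simp
  qed simp
  from this[of m] have "(\<Sum>j=1..Suc m. 1 / (real j)\<^sup>2) \<le> 2"
    by (rule order_trans) simp
  moreover have "(\<Sum>j=1..m. 1 / (real j)\<^sup>2) \<le> (\<Sum>j=1..Suc m. 1 / (real j)\<^sup>2)"
    by (intro sum_mono2) auto
  ultimately show ?thesis by linarith
qed

lemma ln_le_harmonic: "ln (real m) \<le> (\<Sum>j=1..m. 1 / real j)" if "m > 0"
proof -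
  have "ln (real m) \<le> ln (real m + 1)"
    using that by simp
  also have "\<dots> \<le> harm m"
    by (rule ln_le_harm)
  finally show ?thesis
    by (simp add: harm_def inverse_eq_divide)
qed

text \<open>The coefficient is a product of factors \<open>1 - \<mu> / j\<close>. Bounding each by the exponential above, the
  linear parts sum to at least \<open>\<mu> ln m\<close> and give the decay \<open>m powr - \<mu>\<close>, while the quadratic
  parts sum to at most \<open>\<mu>\<^sup>2\<close>. Finally \<open>1 \<le> exp \<mu> / \<mu>\<close>.\<close>

lemma abs_gbinomial_bound:
  assumes "\<mu> > 0" "m > 0"
  shows "\<bar>\<mu> - 1 gchoose m\<bar> \<le> exp (\<mu>\<^sup>2 + \<mu>) / (real m powr \<mu> * \<mu>)"
proof -
  have "\<bar>\<mu> - 1 gchoose m\<bar> = (\<Prod>j=1..m. \<bar>1 - \<mu> / real j\<bar>)"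
  proof -
    have "(\<mu> - 1 gchoose m) = (\<Prod>i=0..<m. (\<mu> - 1 - real i) / real (Suc i))"
      by (simp add: gbinomial_prod_rev fact_prod_Suc prod_dividef)
    also have "\<dots> = (\<Prod>j=1..m. (\<mu> - real j) / real j)"
      by (rule prod.reindex_bij_witness[of _ "\<lambda>j. j - 1" Suc]) (auto simp: algebra_simps)
    finally have "\<bar>\<mu> - 1 gchoose m\<bar> = (\<Prod>j=1..m. \<bar>(\<mu> - real j) / real j\<bar>)"
      by (simp add: abs_prod)
    also have "\<dots> = (\<Prod>j=1..m. \<bar>1 - \<mu> / real j\<bar>)"
    proof (intro prod.cong refl)
      fix j assume "j \<in> {1..m}"
      then have "(\<mu> - real j) / real j = - (1 - \<mu> / real j)"
        by (simp add: field_simps)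
      then show "\<bar>(\<mu> - real j) / real j\<bar> = \<bar>1 - \<mu> / real j\<bar>"
        by (simp only: abs_minus_cancel)
    qed
    finally show ?thesis .
  qed
  also have "\<dots> \<le> (\<Prod>j=1..m. exp ((\<mu> / real j)\<^sup>2 / 2 - \<mu> / real j))"
    by (intro prod_mono conjI abs_ge_zero abs_one_minus_le_exp)
  also have "\<dots> = exp (\<mu>\<^sup>2 / 2 * (\<Sum>j=1..m. 1 / (real j)\<^sup>2) - \<mu> * (\<Sum>j=1..m. 1 / real j))"
    by (simp add: exp_sum[symmetric] sum_subtractf sum_distrib_left power_divide mult.commute)
  also have "\<dots> \<le> exp (\<mu>\<^sup>2 / 2 * 2 - \<mu> * ln (real m))"
    using assms sum_inverse_squares_le_2[of m] ln_le_harmonic[of m]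
    by (intro exp_mono diff_mono mult_left_mono) auto
  also have "\<dots> = exp (\<mu>\<^sup>2) / real m powr \<mu>"
    using assms by (simp add: exp_diff powr_def)
  also have "\<dots> \<le> exp (\<mu>\<^sup>2) / real m powr \<mu> * (exp \<mu> / \<mu>)"
  proof -
    have "\<mu> \<le> exp \<mu>"
      using exp_ge_add_one_self[of \<mu>] by linarith
    then have "1 \<le> exp \<mu> / \<mu>"
      using assms by simp
    from mult_left_mono[OF this, of "exp (\<mu>\<^sup>2) / real m powr \<mu>"] show ?thesis
      by simp
  qed
  finally show ?thesis
    by (simp add: exp_add mult_ac)
qed

section \<open>Repeated integration by parts\<close>

text \<open>The kernel of the Riemann-Liouville integral of order \<open>p + 1 - \<alpha>\<close> on an interval of left
  endpoint \<open>c\<close> and length \<open>h\<close>, minus its truncated expansion about \<open>c\<close>. The degree \<open>m + p\<close> grows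
  with \<open>p\<close> so that the kernels form a chain under differentiation.\<close>

definition remainder_kernel :: "real \<Rightarrow> nat \<Rightarrow> real \<Rightarrow> real \<Rightarrow> nat \<Rightarrow> real \<Rightarrow> real" where
  "remainder_kernel \<alpha> m c h p \<tau> =
     h powr (real p - \<alpha>) / Gamma (real p + 1 - \<alpha>)
       * binomial_remainder (real p - \<alpha>) (m + p) ((\<tau> - c) / h)"

lemma has_real_derivative_remainder_kernel:
  assumes "0 < \<alpha>" "\<alpha> < 1" "0 < h" "\<tau> < c + h"
  shows "(remainder_kernel \<alpha> m c h (Suc p) has_real_derivative
    - remainder_kernel \<alpha> m c h p \<tau>) (at \<tau>)"
proof -
  let ?\<mu> = "real (Suc p) - \<alpha>"
  have "(\<tau> - c) / h < 1"
    using assms by (simp add: field_simps)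
  then have "((\<lambda>\<tau>. binomial_remainder ?\<mu> (Suc (m + p)) ((\<tau> - c) / h)) has_real_derivative
      - ?\<mu> * binomial_remainder (?\<mu> - 1) (m + p) ((\<tau> - c) / h) * (1 / h)) (at \<tau>)"
    by (intro DERIV_chain2[OF has_real_derivative_binomial_remainder])
       (use assms in \<open>auto intro!: derivative_eq_intros\<close>)
  then have deriv: "(remainder_kernel \<alpha> m c h (Suc p) has_real_derivative
      h powr ?\<mu> / Gamma (?\<mu> + 1) *
      (- ?\<mu> * binomial_remainder (?\<mu> - 1) (m + p) ((\<tau> - c) / h) * (1 / h))) (at \<tau>)"
    unfolding remainder_kernel_def
    by (simp only: add_diff_eq diff_add_eq add_Suc_right) (intro DERIV_cmult)
  have "?\<mu> > 0"
    using assms by simp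
  then have "Gamma (?\<mu> + 1) = ?\<mu> * Gamma ?\<mu>"
    using nonpos_Ints_nonpos[of ?\<mu>] by (intro Gamma_plus1) force
  moreover have "h powr ?\<mu> = h powr (?\<mu> - 1) * h"
    using \<open>h > 0\<close> by (simp add: powr_diff del: of_nat_Suc)
  ultimately have "h powr ?\<mu> / Gamma (?\<mu> + 1) * (- ?\<mu> * y * (1 / h)) =
      - (h powr (?\<mu> - 1) / Gamma ?\<mu> * y)" for y
    using \<open>?\<mu> > 0\<close> \<open>h > 0\<close> by (simp del: of_nat_Suc minus_diff_eq)
  moreover have "?\<mu> - 1 = real p - \<alpha>" "?\<mu> = real p + 1 - \<alpha>"
    by simp_all
  ultimately show ?thesis
    using deriv unfolding remainder_kernel_def[of \<alpha> m c h p] by metis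
qed

lemma continuous_on_remainder_kernel:
  assumes "0 < \<alpha>" "\<alpha> < 1" "0 < h" "p > 0"
  shows "continuous_on {c..c + h} (remainder_kernel \<alpha> m c h p)"
  unfolding remainder_kernel_def
  using assms
  by (intro continuous_intros continuous_on_compose2[OF continuous_on_binomial_remainder])
     (auto simp: field_simps)

lemma remainder_kernel_at_left [simp]: "remainder_kernel \<alpha> m c h p c = 0"
  by (simp add: remainder_kernel_def)

lemma abs_remainder_kernel_le:
  assumes "0 < \<alpha>" "\<alpha> < 1" "0 < h" "p > 0" "\<tau> \<in> {c..c + h}"
  shows "\<bar>remainder_kernel \<alpha> m c h p \<tau>\<bar> \<le> h powr (real p - \<alpha>) *
    (exp ((real p - \<alpha>)\<^sup>2 + real p - \<alpha>) /
      (Gamma (real p + 1 - \<alpha>) * real (m + p) powr (real p - \<alpha>) * (real p - \<alpha>)))"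
proof -
  obtain q where q: "p = Suc q"
    using \<open>p > 0\<close> by (cases p) auto
  have Gamma_pos: "Gamma (real p + 1 - \<alpha>) > 0"
    using assms by (intro Gamma_real_pos) auto
  have "\<bar>binomial_remainder (real p - \<alpha>) (m + p) ((\<tau> - c) / h)\<bar>
      \<le> \<bar>real p - \<alpha> - 1 gchoose (m + p)\<bar>"
    unfolding q using assms by (intro abs_binomial_remainder_le) (auto simp: field_simps)
  also have "\<dots> \<le> exp ((real p - \<alpha>)\<^sup>2 + (real p - \<alpha>))
      / (real (m + p) powr (real p - \<alpha>) * (real p - \<alpha>))"
    using assms q by (intro abs_gbinomial_bound) auto
  finally have "h powr (real p - \<alpha>) / Gamma (real p + 1 - \<alpha>) *
      \<bar>binomial_remainder (real p - \<alpha>) (m + p) ((\<tau> - c) / h)\<bar> \<le>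
      h powr (real p - \<alpha>) / Gamma (real p + 1 - \<alpha>) *
      (exp ((real p - \<alpha>)\<^sup>2 + (real p - \<alpha>))
        / (real (m + p) powr (real p - \<alpha>) * (real p - \<alpha>)))"
    using Gamma_pos by (intro mult_left_mono) auto
  then show ?thesis
    using Gamma_pos
    by (simp add: remainder_kernel_def abs_mult add_diff_eq mult_ac)
qed

text \<open>Only the right endpoint contributes boundary terms because the kernels vanish on the left. The
  first step also shows that the singular kernel with index \<open>0\<close> is integrable.\<close>

lemma has_integral_remainder_kernel:
  assumes "0 < \<alpha>" "\<alpha> < 1" "0 < h" "n > 0"
    and deriv: "\<And>p \<tau>. 1 \<le> p \<Longrightarrow> p \<le> n \<Longrightarrow> \<tau> \<in> {c..c + h} \<Longrightarrow>
      (g p has_vector_derivative g (Suc p) \<tau>) (at \<tau> within {c..c + h})"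
    and cont: "continuous_on {c..c + h} (g (Suc n))"
  shows "((\<lambda>\<tau>. remainder_kernel \<alpha> m c h 0 \<tau> * g 1 \<tau>) has_integral
    (\<Sum>p=1..n. - remainder_kernel \<alpha> m c h p (c + h) * g p (c + h))
    + integral {c..c + h} (\<lambda>\<tau>. remainder_kernel \<alpha> m c h n \<tau> * g (Suc n) \<tau>)) {c..c + h}"
proof -
  let ?K = "remainder_kernel \<alpha> m c h"
  have cont_g: "continuous_on {c..c + h} (g p)" if "1 \<le> p" "p \<le> Suc n" for p
  proof (cases "p = Suc n")
    case False
    then show ?thesis
      using that by (intro continuous_on_vector_derivative[OF deriv]) auto
  qed (use cont in simp)
  have parts: "((\<lambda>\<tau>. ?K p \<tau> * g (Suc p) \<tau>) has_integral
      - ?K (Suc p) (c + h) * g (Suc p) (c + h) + y) {c..c + h}"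
    if p: "Suc p \<le> n"
      and y: "((\<lambda>\<tau>. ?K (Suc p) \<tau> * g (Suc (Suc p)) \<tau>) has_integral y) {c..c + h}" for p y
  proof -
    let ?z = "?K (Suc p) (c + h) * g (Suc p) (c + h) - y"
    have "((\<lambda>\<tau>. - ?K p \<tau> * g (Suc p) \<tau>) has_integral ?z) {c..c + h}"
    proof (rule integration_by_parts_interior[OF bounded_bilinear_mult])
      show "continuous_on {c..c + h} (?K (Suc p))"
        using assms by (intro continuous_on_remainder_kernel) auto
      show "continuous_on {c..c + h} (g (Suc p))"
        using p by (intro cont_g) auto
      show "(?K (Suc p) has_vector_derivative - ?K p \<tau>) (at \<tau>)" if "\<tau> \<in> {c<..<c + h}" for \<tau>
        unfolding has_real_derivative_iff_has_vector_derivative[symmetric]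
        using that assms by (intro has_real_derivative_remainder_kernel) auto
      show "(g (Suc p) has_vector_derivative g (Suc (Suc p)) \<tau>) (at \<tau>)"
        if "\<tau> \<in> {c<..<c + h}" for \<tau>
        using deriv[of "Suc p" \<tau>] that p at_within_Icc_at[of c \<tau> "c + h"] by auto
    qed (use y assms in auto)
    from has_integral_neg[OF this] show ?thesis
      by simp
  qed
  \<comment> \<open>Starting from index \<open>n\<close>, where the kernel is continuous, each step lowers the index by one.\<close>
  have rec: "((\<lambda>\<tau>. ?K (n - q) \<tau> * g (Suc (n - q)) \<tau>) has_integral
      (\<Sum>p=Suc (n - q)..n. - ?K p (c + h) * g p (c + h))
      + integral {c..c + h} (\<lambda>\<tau>. ?K n \<tau> * g (Suc n) \<tau>)) {c..c + h}" if "q \<le> n" for q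
    using that
  proof (induction q)
    case 0
    have "(\<lambda>\<tau>. ?K n \<tau> * g (Suc n) \<tau>) integrable_on {c..c + h}"
      using assms
      by (intro integrable_continuous_interval continuous_intros continuous_on_remainder_kernel)
    then show ?case
      by (simp add: has_integral_integral)
  next
    case (Suc q)
    then have eq: "n - q = Suc (n - Suc q)"
      by auto
    have "((\<lambda>\<tau>. ?K (n - Suc q) \<tau> * g (Suc (n - Suc q)) \<tau>) has_integral
        - ?K (n - q) (c + h) * g (n - q) (c + h)
        + ((\<Sum>p=Suc (n - q)..n. - ?K p (c + h) * g p (c + h))
          + integral {c..c + h} (\<lambda>\<tau>. ?K n \<tau> * g (Suc n) \<tau>))) {c..c + h}"
      using Suc.IH Suc.prems parts[of "n - Suc q"] unfolding eq by simp
    also have "- ?K (n - q) (c + h) * g (n - q) (c + h)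
        + ((\<Sum>p=Suc (n - q)..n. - ?K p (c + h) * g p (c + h))
          + integral {c..c + h} (\<lambda>\<tau>. ?K n \<tau> * g (Suc n) \<tau>)) =
        (\<Sum>p=n - q..n. - ?K p (c + h) * g p (c + h))
          + integral {c..c + h} (\<lambda>\<tau>. ?K n \<tau> * g (Suc n) \<tau>)"
      by (subst (2) sum.atLeast_Suc_atMost) auto
    finally show ?case
      unfolding eq .
  qed
  from rec[of n] show ?thesis
    by simp
qed

lemma Gamma_ratio_eq_gbinomial:
  assumes "0 < \<alpha>" "\<alpha> < 1"
  shows "Gamma (\<alpha> - real p + real j) / (Gamma (\<alpha> - real p) * fact j)
    = (-1) ^ j * (real p - \<alpha> gchoose j)"
proof -
  have "\<alpha> - real p \<notin> \<int>\<^sub>\<le>\<^sub>0"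
  proof
    assume "\<alpha> - real p \<in> \<int>\<^sub>\<le>\<^sub>0"
    then obtain i where "\<alpha> - real p = of_int i"
      by (auto elim!: nonpos_Ints_cases)
    then have "\<alpha> = of_int (i + int p)"
      by simp
    with assms have "0 < i + int p" "i + int p < 1"
      by linarith+
    then show False by simp
  qed
  then show ?thesis
    by (simp add: alternating_gbinomial_pochhammer pochhammer_Gamma)
qed

text \<open>At the right endpoint the power itself vanishes, since \<open>p \<ge> 1\<close>, and only the truncated
  expansion remains, whose coefficients are the Gamma quotients in \<open>A\<^sub>p\<close>.\<close>

lemma coeff_A_eq_remainder_kernel:
  assumes "0 < \<alpha>" "\<alpha> < 1" "0 < h" "1 \<le> p" "p \<le> n" "n \<le> N"
  shows "coeff_A n N \<alpha> p * h powr (real p - \<alpha>) = - remainder_kernel \<alpha> (N - n) c h p (c + h)"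
proof -
  let ?c = "\<lambda>j. (-1) ^ j * (real p - \<alpha> gchoose j)"
  have "(\<Sum>l=n - p + 1..N. Gamma (\<alpha> - real n + real l) / (Gamma (\<alpha> - real p) * fact (l + p - n)))
      = (\<Sum>l=1 + (n - p)..N - n + p + (n - p).
          Gamma (\<alpha> - real n + real l) / (Gamma (\<alpha> - real p) * fact (l + p - n)))"
    using assms by (simp add: add.commute)
  also have "\<dots> = (\<Sum>j=1..N - n + p. ?c j)"
    unfolding sum.shift_bounds_cl_nat_ivl
  proof (intro sum.cong refl)
    fix j
    have "\<alpha> - real n + real (j + (n - p)) = \<alpha> - real p + real j" "j + (n - p) + p - n = j"
      using assms by (auto simp: of_nat_diff)
    then show "Gamma (\<alpha> - real n + real (j + (n - p))) /
        (Gamma (\<alpha> - real p) * fact (j + (n - p) + p - n)) = ?c j"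
      by (simp only: Gamma_ratio_eq_gbinomial[OF assms(1,2)])
  qed
  finally have "coeff_A n N \<alpha> p = 1 / Gamma (real p + 1 - \<alpha>) * (\<Sum>j\<le>N - n + p. ?c j)"
    by (simp add: coeff_A_def atMost_atLeast0 sum.atLeast_Suc_atMost)
  then show ?thesis
    using assms by (simp add: remainder_kernel_def binomial_remainder_def)
qed

text \<open>The splitting also holds at \<open>\<tau> = c + h\<close>, where both powers of \<open>0\<close> are \<open>0\<close>.\<close>

lemma fractional_kernel_split:
  assumes "0 < \<alpha>" "\<alpha> < 1" "0 < h" "n \<le> N" "\<tau> \<in> {c..c + h}"
  shows "1 / Gamma (1 - \<alpha>) * (c + h - \<tau>) powr (- \<alpha>) = remainder_kernel \<alpha> (N - n) c h 0 \<tau>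
    + (\<Sum>p=n..N. coeff_B n \<alpha> p * h powr (real n - real p - \<alpha>) * (\<tau> - c) ^ (p - n))"
proof -
  have "(\<Sum>p=n..N. coeff_B n \<alpha> p * h powr (real n - real p - \<alpha>) * (\<tau> - c) ^ (p - n)) =
      (\<Sum>p=0 + n..N - n + n. coeff_B n \<alpha> p * h powr (real n - real p - \<alpha>) * (\<tau> - c) ^ (p - n))"
    using assms by simp
  also have "\<dots> = (\<Sum>j\<le>N - n. h powr (- \<alpha>) / Gamma (1 - \<alpha>)
      * ((-1) ^ j * (- \<alpha> gchoose j) * ((\<tau> - c) / h) ^ j))"
    unfolding sum.shift_bounds_cl_nat_ivl atMost_atLeast0
  proof (intro sum.cong refl)
    fix j
    have "h powr (real n - real (j + n) - \<alpha>) = h powr (- \<alpha>) / h ^ j"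
      using assms by (simp add: powr_diff powr_realpow powr_minus divide_simps)
    then show "coeff_B n \<alpha> (j + n) * h powr (real n - real (j + n) - \<alpha>) * (\<tau> - c) ^ (j + n - n)
        = h powr (- \<alpha>) / Gamma (1 - \<alpha>) * ((-1) ^ j * (- \<alpha> gchoose j) * ((\<tau> - c) / h) ^ j)"
      using Gamma_ratio_eq_gbinomial[of \<alpha> 0 j, symmetric] assms
      by (simp add: coeff_B_def power_divide mult_ac)
  qed
  finally have sum: "(\<Sum>p=n..N. coeff_B n \<alpha> p * h powr (real n - real p - \<alpha>) * (\<tau> - c) ^ (p - n))
      = h powr (- \<alpha>) / Gamma (1 - \<alpha>)
        * (\<Sum>j\<le>N - n. (-1) ^ j * (- \<alpha> gchoose j) * ((\<tau> - c) / h) ^ j)"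
    by (simp add: sum_distrib_left)
  have "c + h - \<tau> = h * (1 - (\<tau> - c) / h)"
    using assms by (simp add: field_simps)
  then have "(c + h - \<tau>) powr (- \<alpha>) = h powr (- \<alpha>) * (1 - (\<tau> - c) / h) powr (- \<alpha>)"
    using assms by (simp only:) (subst powr_mult, auto simp: field_simps)
  then show ?thesis
    unfolding sum remainder_kernel_def binomial_remainder_def by (simp add: algebra_simps)
qed

lemma integral_fractional_kernel:
  assumes \<alpha>: "0 < \<alpha>" "\<alpha> < 1" and h: "0 < h" and n: "n > 0" "n \<le> N"
    and deriv: "\<And>p \<tau>. 1 \<le> p \<Longrightarrow> p \<le> n \<Longrightarrow> \<tau> \<in> {c..c + h} \<Longrightarrow>
      (g p has_vector_derivative g (Suc p) \<tau>) (at \<tau> within {c..c + h})"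
    and cont: "continuous_on {c..c + h} (g (Suc n))"
  shows "1 / Gamma (1 - \<alpha>) * integral {c..c + h} (\<lambda>\<tau>. (c + h - \<tau>) powr (- \<alpha>) * g 1 \<tau>) =
    (\<Sum>p=1..n. coeff_A n N \<alpha> p * h powr (real p - \<alpha>) * g p (c + h))
    + (\<Sum>p=n..N. coeff_B n \<alpha> p * h powr (real n - real p - \<alpha>)
        * integral {c..c + h} (\<lambda>\<tau>. (\<tau> - c) ^ (p - n) * g 1 \<tau>))
    + integral {c..c + h} (\<lambda>\<tau>. remainder_kernel \<alpha> (N - n) c h n \<tau> * g (Suc n) \<tau>)"
proof -
  let ?K = "remainder_kernel \<alpha> (N - n) c h"
  let ?b = "\<lambda>p. coeff_B n \<alpha> p * h powr (real n - real p - \<alpha>)"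
  have cont1: "continuous_on {c..c + h} (g 1)"
    using n by (intro continuous_on_vector_derivative[OF deriv]) auto
  have "((\<lambda>\<tau>. ?b p * ((\<tau> - c) ^ (p - n) * g 1 \<tau>)) has_integral
      ?b p * integral {c..c + h} (\<lambda>\<tau>. (\<tau> - c) ^ (p - n) * g 1 \<tau>)) {c..c + h}" for p
    using cont1
    by (intro has_integral_mult_right integrable_integral integrable_continuous_interval
        continuous_intros)
  then have poly: "((\<lambda>\<tau>. \<Sum>p=n..N. ?b p * ((\<tau> - c) ^ (p - n) * g 1 \<tau>)) has_integral
      (\<Sum>p=n..N. ?b p * integral {c..c + h} (\<lambda>\<tau>. (\<tau> - c) ^ (p - n) * g 1 \<tau>))) {c..c + h}"
    by (intro has_integral_sum) auto
  have "((\<lambda>\<tau>. ?K 0 \<tau> * g 1 \<tau> + (\<Sum>p=n..N. ?b p * ((\<tau> - c) ^ (p - n) * g 1 \<tau>))) has_integral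
      ((\<Sum>p=1..n. - ?K p (c + h) * g p (c + h))
        + integral {c..c + h} (\<lambda>\<tau>. ?K n \<tau> * g (Suc n) \<tau>))
      + (\<Sum>p=n..N. ?b p * integral {c..c + h} (\<lambda>\<tau>. (\<tau> - c) ^ (p - n) * g 1 \<tau>))) {c..c + h}"
    using assms by (intro has_integral_add[OF has_integral_remainder_kernel poly]) auto
  moreover have "?K 0 \<tau> * g 1 \<tau> + (\<Sum>p=n..N. ?b p * ((\<tau> - c) ^ (p - n) * g 1 \<tau>)) =
      1 / Gamma (1 - \<alpha>) * ((c + h - \<tau>) powr (- \<alpha>) * g 1 \<tau>)" if "\<tau> \<in> {c..c + h}" for \<tau>
  proof -
    have "?K 0 \<tau> * g 1 \<tau> + (\<Sum>p=n..N. ?b p * ((\<tau> - c) ^ (p - n) * g 1 \<tau>)) =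
        (?K 0 \<tau> + (\<Sum>p=n..N. ?b p * (\<tau> - c) ^ (p - n))) * g 1 \<tau>"
      by (simp add: distrib_right sum_distrib_right mult.assoc)
    also have "\<dots> = 1 / Gamma (1 - \<alpha>) * (c + h - \<tau>) powr (- \<alpha>) * g 1 \<tau>"
      by (simp only: fractional_kernel_split[OF \<alpha> h n(2) that])
    finally show ?thesis
      by (simp only: mult.assoc)
  qed
  ultimately have int: "((\<lambda>\<tau>. 1 / Gamma (1 - \<alpha>) * ((c + h - \<tau>) powr (- \<alpha>) * g 1 \<tau>)) has_integral
      ((\<Sum>p=1..n. - ?K p (c + h) * g p (c + h))
        + integral {c..c + h} (\<lambda>\<tau>. ?K n \<tau> * g (Suc n) \<tau>))
      + (\<Sum>p=n..N. ?b p * integral {c..c + h} (\<lambda>\<tau>. (\<tau> - c) ^ (p - n) * g 1 \<tau>))) {c..c + h}"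
    by (rule has_integral_eq[rotated])
  have boundary: "(\<Sum>p=1..n. - ?K p (c + h) * g p (c + h)) =
      (\<Sum>p=1..n. coeff_A n N \<alpha> p * h powr (real p - \<alpha>) * g p (c + h))"
    using assms by (intro sum.cong refl) (simp add: coeff_A_eq_remainder_kernel[where c = c])
  show ?thesis
    using integral_unique[OF int] unfolding boundary integral_mult_right by simp
qed

lemma integral_remainder_kernel_le:
  assumes "0 < \<alpha>" "\<alpha> < 1" "0 < h" "n > 0" "n \<le> N"
    and cont: "continuous_on {c..c + h} f"
    and L: "\<And>\<tau>. \<tau> \<in> {c..c + h} \<Longrightarrow> \<bar>f \<tau>\<bar> \<le> L"
  shows "integral {c..c + h} (\<lambda>\<tau>. remainder_kernel \<alpha> (N - n) c h n \<tau> * f \<tau>)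
    \<le> L * (exp ((real n - \<alpha>)\<^sup>2 + real n - \<alpha>)
        / (Gamma (real n + 1 - \<alpha>) * real N powr (real n - \<alpha>) * (real n - \<alpha>)))
      * h powr (real n + 1 - \<alpha>)"
proof -
  let ?K = "remainder_kernel \<alpha> (N - n) c h n"
  let ?C = "exp ((real n - \<alpha>)\<^sup>2 + real n - \<alpha>)
    / (Gamma (real n + 1 - \<alpha>) * real N powr (real n - \<alpha>) * (real n - \<alpha>))"
  have "norm (integral {c..c + h} (\<lambda>\<tau>. ?K \<tau> * f \<tau>)) \<le> h powr (real n - \<alpha>) * ?C * L * (c + h - c)"
  proof (rule integral_bound)
    fix \<tau> assume \<tau>: "\<tau> \<in> {c..c + h}"
    have K: "\<bar>?K \<tau>\<bar> \<le> h powr (real n - \<alpha>) * ?C"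
      using abs_remainder_kernel_le[of \<alpha> h n \<tau> c "N - n"] assms \<tau> by simp
    then show "norm (?K \<tau> * f \<tau>) \<le> h powr (real n - \<alpha>) * ?C * L"
      unfolding real_norm_def abs_mult
      by (rule mult_mono[OF _ L[OF \<tau>]]) (use K in linarith, simp)
  qed (use assms in \<open>auto intro!: continuous_intros continuous_on_remainder_kernel\<close>)
  moreover have "h powr (real n + 1 - \<alpha>) = h powr (real n - \<alpha>) * h"
    using assms powr_add[of h "real n - \<alpha>" 1] by (simp add: algebra_simps)
  then have "L * ?C * h powr (real n + 1 - \<alpha>) = h powr (real n - \<alpha>) * ?C * L * (c + h - c)"
    by (simp add: mult_ac)
  ultimately show ?thesis
    unfolding real_norm_def by (simp only: order_trans[OF abs_ge_self])
qed

section \<open>Restricting to a coordinate line\<close>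

lemma replace_coord_replace_coord [simp]:
  "replace_coord (replace_coord t k s) k \<tau> = replace_coord t k \<tau>"
  by (simp add: replace_coord_def vec_eq_iff)

lemma replace_coord_nth [simp]: "replace_coord t k s $ k = s"
  by (simp add: replace_coord_def)

lemma replace_coord_in_cbox:
  assumes "t \<in> cbox a b" "s \<in> {a $ k..b $ k}"
  shows "replace_coord t k s \<in> cbox a b"
  using assms by (auto simp: replace_coord_def mem_box_cart)

lemma C_on_box_partial_pow:
  assumes "C_on_box r a b x" "p \<le> r"
  shows "C_on_box (r - p) a b (partial_pow a b k p x)"
  using assms(2)
proof (induction p)
  case 0
  then show ?case
    using assms by (simp add: partial_pow_def)
next
  case (Suc p)
  then have "C_on_box (Suc (r - Suc p)) a b (partial_pow a b k p x)"
    by (simp add: Suc_diff_Suc)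
  then show ?case
    by (simp add: partial_pow_def)
qed

lemma C_on_box_imp_continuous_on: "C_on_box r a b x \<Longrightarrow> continuous_on (cbox a b) x"
  by (cases r) auto

lemma continuous_on_partial_pow_line:
  assumes "C_on_box r a b x" "p \<le> r" "t \<in> cbox a b"
  shows "continuous_on {a $ k..b $ k} (\<lambda>\<tau>. partial_pow a b k p x (replace_coord t k \<tau>))"
proof (rule continuous_on_compose2[of "cbox a b" "partial_pow a b k p x" _ "replace_coord t k"])
  show "continuous_on (cbox a b) (partial_pow a b k p x)"
    using C_on_box_partial_pow[OF assms(1,2)] by (rule C_on_box_imp_continuous_on)
  have "continuous_on {a $ k..b $ k} (\<lambda>\<tau>. if i = k then \<tau> else t $ i)" for i
    by (cases "i = k") auto
  then show "continuous_on {a $ k..b $ k} (replace_coord t k)"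
    unfolding replace_coord_def by (intro continuous_on_vec_lambda)
qed (use assms replace_coord_in_cbox in blast)

lemma has_vector_derivative_partial_pow_line:
  assumes "C_on_box r a b x" "p < r" "t \<in> cbox a b" "s \<in> {a $ k..b $ k}"
  shows "((\<lambda>\<tau>. partial_pow a b k p x (replace_coord t k \<tau>)) has_vector_derivative
    partial_pow a b k (Suc p) x (replace_coord t k s)) (at s within {a $ k..b $ k})"
proof -
  have "C_on_box (Suc (r - Suc p)) a b (partial_pow a b k p x)"
    using C_on_box_partial_pow[of r a b x p k] assms by (simp add: Suc_diff_Suc)
  then have "has_partial_on_box a b k (partial_pow a b k p x)"
    by simp
  then have "(\<lambda>\<tau>. partial_pow a b k p x (replace_coord t k \<tau>)) differentiable
      (at s within {a $ k..b $ k})"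
    using replace_coord_in_cbox[OF assms(3,4)] unfolding has_partial_on_box_def by force
  then show ?thesis
    by (simp add: vector_derivative_works partial_pow_def partial_def)
qed

text \<open>Compactness of the segment makes the maximum an attained one, so that the \<open>GREATEST\<close> in
  \<open>L_max\<close> denotes it.\<close>

lemma abs_partial_pow_le_L_max:
  assumes "C_on_box r a b x" "p \<le> r" "t \<in> cbox a b" "\<tau> \<in> {a $ k..t $ k}"
  shows "\<bar>partial_pow a b k p x (replace_coord t k \<tau>)\<bar> \<le> L_max a b k x p t"
proof -
  let ?S = "(\<lambda>\<tau>. \<bar>partial_pow a b k p x (replace_coord t k \<tau>)\<bar>) ` {a $ k..t $ k}"
  have "{a $ k..t $ k} \<subseteq> {a $ k..b $ k}"
    using assms(3) by (auto simp: mem_box_cart intro: order_trans)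
  then have "compact ?S"
    by (intro compact_continuous_image continuous_on_rabs compact_Icc
        continuous_on_subset[OF continuous_on_partial_pow_line[OF assms(1-3)]])
  moreover have "?S \<noteq> {}"
    using assms(4) by auto
  ultimately obtain M where "M \<in> ?S" "\<forall>y\<in>?S. y \<le> M"
    using compact_attains_sup[of ?S] by blast
  moreover from this have "L_max a b k x p t = M"
    unfolding L_max_def by (intro Greatest_equality) blast+
  moreover have "\<bar>partial_pow a b k p x (replace_coord t k \<tau>)\<bar> \<in> ?S"
    using assms(4) by (rule imageI)
  ultimately show ?thesis
    by metis
qed

theorem theorem10:
  fixes a b :: "real ^ 'm" and x :: "real ^ 'm \<Rightarrow> real"
    and \<alpha> :: "'m \<Rightarrow> real \<Rightarrow> real" and n :: nat
  assumes n: "n \<ge> 1"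
    and x: "C_on_box (n + 1) a b x"
    and \<alpha>: "\<And>k s. s \<in> {a $ k..b $ k} \<Longrightarrow> \<alpha> k s \<in> {0<..<1}"
  shows "\<forall>k. \<forall>N \<ge> n. \<forall>t \<in> cbox a b. a $ k < t $ k \<longrightarrow>
    (\<exists>E :: real.
      caputo3 a b k (\<alpha> k) x t =
        (\<Sum>p = 1..n. coeff_A n N (\<alpha> k (t $ k)) p
            * (t $ k - a $ k) powr (real p - \<alpha> k (t $ k))
            * partial_pow a b k p x (replace_coord t k (t $ k)))
        + (\<Sum>p = n..N. coeff_B n (\<alpha> k (t $ k)) p
            * (t $ k - a $ k) powr (real n - real p - \<alpha> k (t $ k))
            * V_int a b k x n p t)
        + E
      \<and> E \<le> L_max a b k x (n + 1) t
            * (exp ((real n - \<alpha> k (t $ k))\<^sup>2 + real n - \<alpha> k (t $ k))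
               / (Gamma (real n + 1 - \<alpha> k (t $ k)) * real N powr (real n - \<alpha> k (t $ k))
                  * (real n - \<alpha> k (t $ k))))
            * (t $ k - a $ k) powr (real n + 1 - \<alpha> k (t $ k)))"
proof (intro allI impI ballI)
  fix k N and t :: "real ^ 'm"
  assume N: "N \<ge> n" and t: "t \<in> cbox a b" and lt: "a $ k < t $ k"
  let ?\<alpha> = "\<alpha> k (t $ k)" and ?c = "a $ k" and ?h = "t $ k - a $ k"
  let ?g = "\<lambda>p \<tau>. partial_pow a b k p x (replace_coord t k \<tau>)"
  let ?E = "integral {?c..t $ k} (\<lambda>\<tau>. remainder_kernel ?\<alpha> (N - n) ?c ?h n \<tau> * ?g (Suc n) \<tau>)"
  have tk: "t $ k \<in> {a $ k..b $ k}"
    using t by (auto simp: mem_box_cart)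
  then have \<alpha>_bounds: "0 < ?\<alpha>" "?\<alpha> < 1"
    using \<alpha>[of "t $ k" k] by auto
  have sub: "{?c..t $ k} \<subseteq> {a $ k..b $ k}"
    using tk by auto
  have partial: "partial a b k x = partial_pow a b k 1 x"
    by (simp add: partial_pow_def)
  have deriv: "(?g p has_vector_derivative ?g (Suc p) \<tau>) (at \<tau> within {?c..?c + ?h})"
    if "1 \<le> p" "p \<le> n" "\<tau> \<in> {?c..?c + ?h}" for p \<tau>
    using that sub
    by (intro has_vector_derivative_within_subset[OF
          has_vector_derivative_partial_pow_line[OF x _ t]]) auto
  have cont: "continuous_on {?c..?c + ?h} (?g (Suc n))"
    using sub continuous_on_partial_pow_line[OF x _ t, of "Suc n" k]
    by (auto intro: continuous_on_subset)
  have "caputo3 a b k (\<alpha> k) x t =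
      (\<Sum>p = 1..n. coeff_A n N ?\<alpha> p * ?h powr (real p - ?\<alpha>) * ?g p (t $ k))
      + (\<Sum>p = n..N. coeff_B n ?\<alpha> p * ?h powr (real n - real p - ?\<alpha>) * V_int a b k x n p t)
      + ?E"
    using integral_fractional_kernel[of ?\<alpha> ?h n N ?c ?g, OF \<alpha>_bounds _ _ N deriv cont] n lt
    by (simp add: caputo3_def V_int_def partial)
  moreover have "?E \<le> L_max a b k x (n + 1) t
      * (exp ((real n - ?\<alpha>)\<^sup>2 + real n - ?\<alpha>)
         / (Gamma (real n + 1 - ?\<alpha>) * real N powr (real n - ?\<alpha>) * (real n - ?\<alpha>)))
      * ?h powr (real n + 1 - ?\<alpha>)"
    using integral_remainder_kernel_le[of ?\<alpha> ?h n N ?c "?g (Suc n)" "L_max a b k x (n + 1) t",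
        OF \<alpha>_bounds _ _ N cont] abs_partial_pow_le_L_max[OF x _ t, of "Suc n"] n lt
    by simp
  ultimately show "\<exists>E :: real.
      caputo3 a b k (\<alpha> k) x t =
        (\<Sum>p = 1..n. coeff_A n N ?\<alpha> p * ?h powr (real p - ?\<alpha>) * ?g p (t $ k))
        + (\<Sum>p = n..N. coeff_B n ?\<alpha> p * ?h powr (real n - real p - ?\<alpha>) * V_int a b k x n p t)
        + E
      \<and> E \<le> L_max a b k x (n + 1) t
        * (exp ((real n - ?\<alpha>)\<^sup>2 + real n - ?\<alpha>)
           / (Gamma (real n + 1 - ?\<alpha>) * real N powr (real n - ?\<alpha>) * (real n - ?\<alpha>)))
        * ?h powr (real n + 1 - ?\<alpha>)"
    by blast
qed

end
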